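(* Let $(X,\Sigma,\mu)$ be a complete $\sigma$-finite measure space, let $\Phi$ be a Young's function with complementary function $\Psi$, let $\varphi:X\to X$ be a non-singular measurable transformation, and let $h=\frac{d\mu\circ\varphi^{-1}}{d\mu}$. Suppose that $h<\infty$ $\mu$-a.e. and $\Psi\in\Delta'$. Then the composition operator $C_\varphi:\mathcal{D}(C_\varphi)\to L^\Phi(\mu)$, $C_\varphi(f)=f\circ\varphi$, on $L^\Phi(\mu)$ is continuous if and only if it is everywhere defined, i.e. $\mathcal{D}(C_\varphi)=L^\Phi(\mu)$.
   Context: A Young's function is a convex even function $\Phi:\mathbb{R}\to[0,\infty]$ with $\Phi(0)=0$ and $\lim_{x\to\infty}\Phi(x)=+\infty$. Its complementary function is $\Psi(y)=\sup\{x|y|-\Phi(x):x\ge 0\}$, $y\in\mathbb{R}$. $\Psi\in\Delta'$ means there are $d>0$, $x_0>0$ with $\Psi(xy)\le d\,\Psi(x)\Psi(y)$ for all $x,y\ge x_0$. $L^0(\Sigma)$ is the space of equivalence classes (mod $\mu$-a.e. equality) of $\Sigma$-measurable real-valued functions on $X$. The Orlicz space is $L^\Phi(\mu)=\{f\in L^0(\Sigma):\exists k>0,\ \int_X\Phi(kf)\,d\mu<\infty\}$, a Banach space under $N_\Phi(f)=\inf\{k>0:\int_X\Phi(f/k)\,d\mu\le 1\}$. A measurable transformation $\varphi:X\to X$ is non-singular if $\varphi^{-1}(F)\in\Sigma$ for all $F\in\Sigma$ and $\mu(\varphi^{-1}(F))=0$ whenever $\mu(F)=0$. The function $h:X\to[0,\infty]$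 satisfies $\mu(\varphi^{-1}(A))=\int_A h\,d\mu$ for all $A\in\Sigma$. The domain is $\mathcal{D}(C_\varphi)=\{f\in L^\Phi(\mu): f\circ\varphi\in L^\Phi(\mu)\}$, equipped with the norm $N_\Phi$ inherited from $L^\Phi(\mu)$. *)

theory Defs
  imports "HOL-Analysis.Analysis"
begin

section \<open>Young's functions\<close>

definition youngs_function :: "(real \<Rightarrow> ennreal) \<Rightarrow> bool" where
  "youngs_function \<Phi> \<longleftrightarrow>
     (\<forall>x y u v. 0 \<le> u \<longrightarrow> 0 \<le> v \<longrightarrow> u + v = 1 \<longrightarrow>
        \<Phi> (u * x + v * y) \<le> ennreal u * \<Phi> x + ennreal v * \<Phi> y) \<and>
     (\<forall>x. \<Phi> (- x) = \<Phi> x) \<and>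
     \<Phi> 0 = 0 \<and>
     (\<Phi> \<longlongrightarrow> \<infinity>) at_top"

text \<open>The supremum is taken in the extended reals, so that \<open>x * \<bar>y\<bar> - \<Phi> x = - \<infinity>\<close> where \<open>\<Phi> x = \<infinity>\<close>;
  it is nonnegative because of the term \<open>x = 0\<close>.\<close>

definition complementary :: "(real \<Rightarrow> ennreal) \<Rightarrow> real \<Rightarrow> ereal" where
  "complementary \<Phi> y = (SUP x\<in>{0..}. ereal (x * \<bar>y\<bar>) - enn2ereal (\<Phi> x))"

definition Delta_prime :: "(real \<Rightarrow> ereal) \<Rightarrow> bool" where
  "Delta_prime \<Psi> \<longleftrightarrow>
     (\<exists>d::real. \<exists>x0::real. d > 0 \<and> x0 > 0 \<and>
        (\<forall>x y. x0 \<le> x \<longrightarrow> x0 \<le> y \<longrightarrow> \<Psi> (x * y) \<le> ereal d * \<Psi> x * \<Psi> y))"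

section \<open>Measurable functions modulo almost everywhere equality\<close>

definition ae_rel :: "'a measure \<Rightarrow> (('a \<Rightarrow> real) \<times> ('a \<Rightarrow> real)) set" where
  "ae_rel M = {(f, g). f \<in> borel_measurable M \<and> g \<in> borel_measurable M \<and> (AE x in M. f x = g x)}"

definition L0 :: "'a measure \<Rightarrow> ('a \<Rightarrow> real) set set" where
  "L0 M = borel_measurable M // ae_rel M"

definition L0_diff ::
    "'a measure \<Rightarrow> ('a \<Rightarrow> real) set \<Rightarrow> ('a \<Rightarrow> real) set \<Rightarrow> ('a \<Rightarrow> real) set" where
  "L0_diff M F G = (\<Union>f\<in>F. \<Union>g\<in>G. ae_rel M `` {\<lambda>x. f x - g x})"

section \<open>Orlicz spaces\<close>

text \<open>The integrals below do not depend on the chosen representative of a class.\<close>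

definition orlicz_space :: "'a measure \<Rightarrow> (real \<Rightarrow> ennreal) \<Rightarrow> ('a \<Rightarrow> real) set set" where
  "orlicz_space M \<Phi> = {F \<in> L0 M. \<exists>f\<in>F. \<exists>k>0. (\<integral>\<^sup>+ x. \<Phi> (k * f x) \<partial>M) < \<infinity>}"

definition orlicz_norm :: "'a measure \<Rightarrow> (real \<Rightarrow> ennreal) \<Rightarrow> ('a \<Rightarrow> real) set \<Rightarrow> real" where
  "orlicz_norm M \<Phi> F = Inf {k. 0 < k \<and> (\<exists>f\<in>F. (\<integral>\<^sup>+ x. \<Phi> (f x / k) \<partial>M) \<le> 1)}"

text \<open>The value off the Orlicz space is irrelevant; it is fixed to \<open>0\<close> because
  \<^locale>\<open>Metric_space\<close> requires nonnegativity and symmetry for all arguments.\<close>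

definition orlicz_dist ::
    "'a measure \<Rightarrow> (real \<Rightarrow> ennreal) \<Rightarrow> ('a \<Rightarrow> real) set \<Rightarrow> ('a \<Rightarrow> real) set \<Rightarrow> real" where
  "orlicz_dist M \<Phi> F G =
     (if F \<in> orlicz_space M \<Phi> \<and> G \<in> orlicz_space M \<Phi> then orlicz_norm M \<Phi> (L0_diff M F G) else 0)"

section \<open>Composition operators\<close>

definition nonsingular :: "'a measure \<Rightarrow> ('a \<Rightarrow> 'a) \<Rightarrow> bool" where
  "nonsingular M \<phi> \<longleftrightarrow> \<phi> \<in> M \<rightarrow>\<^sub>M M \<and>
     (\<forall>F\<in>sets M. emeasure M F = 0 \<longrightarrow> emeasure M (\<phi> -` F \<inter> space M) = 0)"

definition comp_op :: "'a measure \<Rightarrow> ('a \<Rightarrow> 'a) \<Rightarrow> ('a \<Rightarrow> real) set \<Rightarrow> ('a \<Rightarrow> real) set" where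
  "comp_op M \<phi> F = (\<Union>f\<in>F. ae_rel M `` {f \<circ> \<phi>})"

definition comp_domain ::
    "'a measure \<Rightarrow> (real \<Rightarrow> ennreal) \<Rightarrow> ('a \<Rightarrow> 'a) \<Rightarrow> ('a \<Rightarrow> real) set set" where
  "comp_domain M \<Phi> \<phi> = {F \<in> orlicz_space M \<Phi>. comp_op M \<phi> F \<in> orlicz_space M \<Phi>}"

section \<open>Well-definedness\<close>

lemma equiv_ae_rel: "equiv (borel_measurable M) (ae_rel M)"
proof (rule equivI)
  show "ae_rel M \<subseteq> borel_measurable M \<times> borel_measurable M"
    by (auto simp: ae_rel_def)
  show "refl_on (borel_measurable M) (ae_rel M)"
    by (simp add: ae_rel_def refl_on_def)
  show "sym (ae_rel M)"
  proof (rule symI)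
    fix f g assume "(f, g) \<in> ae_rel M"
    then show "(g, f) \<in> ae_rel M"
      unfolding ae_rel_def by auto
  qed
  show "trans (ae_rel M)"
  proof (rule transI)
    fix f g h assume "(f, g) \<in> ae_rel M" "(g, h) \<in> ae_rel M"
    then show "(f, h) \<in> ae_rel M"
      unfolding ae_rel_def by auto
  qed
qed

lemma in_ae_class: "g \<in> ae_rel M `` {f} \<longleftrightarrow>
    f \<in> borel_measurable M \<and> g \<in> borel_measurable M \<and> (AE x in M. f x = g x)"
  by (simp add: ae_rel_def)

lemma L0E:
  assumes "F \<in> L0 M"
  obtains f where "f \<in> borel_measurable M" "F = ae_rel M `` {f}"
  using assms unfolding L0_def by (auto elim: quotientE)

lemma ae_class_eq:
  assumes "f \<in> borel_measurable M" "g \<in> borel_measurable M"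
  shows "ae_rel M `` {f} = ae_rel M `` {g} \<longleftrightarrow> (AE x in M. f x = g x)"
  using eq_equiv_class_iff[OF equiv_ae_rel assms] assms by (simp add: ae_rel_def)

lemma L0_diff_class:
  assumes f: "f \<in> borel_measurable M" and g: "g \<in> borel_measurable M"
  shows "L0_diff M (ae_rel M `` {f}) (ae_rel M `` {g}) = ae_rel M `` {\<lambda>x. f x - g x}"
proof -
  have "ae_rel M `` {\<lambda>x. f' x - g' x} = ae_rel M `` {\<lambda>x. f x - g x}"
    if "f' \<in> ae_rel M `` {f}" "g' \<in> ae_rel M `` {g}" for f' g'
  proof (subst ae_class_eq)
    show "AE x in M. f' x - g' x = f x - g x"
      using that unfolding in_ae_class by auto
  qed (use that f g in \<open>auto simp: in_ae_class simp del: Image_singleton_iff\<close>)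
  moreover have "f \<in> ae_rel M `` {f}" "g \<in> ae_rel M `` {g}"
    unfolding in_ae_class using f g by auto
  ultimately show ?thesis unfolding L0_diff_def by blast
qed

lemma comp_op_class:
  assumes "nonsingular M \<phi>" and f: "f \<in> borel_measurable M"
  shows "comp_op M \<phi> (ae_rel M `` {f}) = ae_rel M `` {f \<circ> \<phi>}"
proof -
  have phi: "\<phi> \<in> M \<rightarrow>\<^sub>M M" using assms by (simp add: nonsingular_def)
  have "ae_rel M `` {f' \<circ> \<phi>} = ae_rel M `` {f \<circ> \<phi>}" if "f' \<in> ae_rel M `` {f}" for f'
  proof -
    from that have f': "f' \<in> borel_measurable M" and eq: "AE x in M. f x = f' x"
      unfolding in_ae_class by auto
    from AE_E[OF eq] obtain N where N: "{x \<in> space M. f x \<noteq> f' x} \<subseteq> N" "emeasure M N = 0" "N \<in> sets M"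
      by metis
    have "AE x in M. (f' \<circ> \<phi>) x = (f \<circ> \<phi>) x"
    proof (rule AE_I)
      show "{x \<in> space M. (f' \<circ> \<phi>) x \<noteq> (f \<circ> \<phi>) x} \<subseteq> \<phi> -` N \<inter> space M"
        using N(1) measurable_space[OF phi] by fastforce
      show "emeasure M (\<phi> -` N \<inter> space M) = 0"
        using N assms by (auto simp: nonsingular_def)
      show "\<phi> -` N \<inter> space M \<in> sets M"
        using N phi by (rule_tac measurable_sets)
    qed
    then show ?thesis
      by (subst ae_class_eq) (use f f' phi in \<open>auto intro: measurable_comp\<close>)
  qed
  moreover have "f \<in> ae_rel M `` {f}"
    unfolding in_ae_class using f by auto
  ultimately show ?thesis unfolding comp_op_def by blast
qed

context
  fixes \<Phi> :: "real \<Rightarrow> ennreal"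
  assumes Y: "youngs_function \<Phi>"
begin

lemma young_convex: "0 \<le> u \<Longrightarrow> 0 \<le> v \<Longrightarrow> u + v = 1 \<Longrightarrow>
    \<Phi> (u * x + v * y) \<le> ennreal u * \<Phi> x + ennreal v * \<Phi> y"
  using Y unfolding youngs_function_def by blast

lemma young_even: "\<Phi> (- x) = \<Phi> x" and young_0: "\<Phi> 0 = 0"
  and young_lim: "(\<Phi> \<longlongrightarrow> \<infinity>) at_top"
  using Y unfolding youngs_function_def by blast+

lemma young_abs: "\<Phi> \<bar>x\<bar> = \<Phi> x"
  by (simp add: abs_if young_even)

lemma young_scale:
  assumes "0 \<le> u" "u \<le> 1"
  shows "\<Phi> (u * x) \<le> ennreal u * \<Phi> x"
  using young_convex[of u "1 - u" x 0] assms by (simp add: young_0)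

lemma young_mono:
  assumes "\<bar>x\<bar> \<le> \<bar>y\<bar>"
  shows "\<Phi> x \<le> \<Phi> y"
proof (cases "y = 0")
  case False
  have "\<Phi> \<bar>x\<bar> = \<Phi> (\<bar>x\<bar> / \<bar>y\<bar> * \<bar>y\<bar>)" using False by simp
  also have "\<dots> \<le> ennreal (\<bar>x\<bar> / \<bar>y\<bar>) * \<Phi> \<bar>y\<bar>"
    using assms False by (intro young_scale) auto
  also have "\<dots> \<le> 1 * \<Phi> \<bar>y\<bar>"
    using assms False by (intro mult_right_mono) auto
  finally show ?thesis by (simp add: young_abs)
qed (use assms in auto)

lemma young_measurable [measurable]: "\<Phi> \<in> borel_measurable borel"
proof (rule borel_measurableI_le)
  fix a
  have "is_interval {x. \<Phi> x \<le> a}"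
    unfolding is_interval_1
  proof (intro ballI allI impI; elim conjE)
    fix x y z assume "x \<in> {x. \<Phi> x \<le> a}" "y \<in> {x. \<Phi> x \<le> a}" "x \<le> z" "z \<le> y"
    moreover from this have "\<bar>z\<bar> \<le> \<bar>x\<bar> \<or> \<bar>z\<bar> \<le> \<bar>y\<bar>" by linarith
    then have "\<Phi> z \<le> \<Phi> x \<or> \<Phi> z \<le> \<Phi> y" using young_mono by blast
    ultimately show "z \<in> {x. \<Phi> x \<le> a}" by auto
  qed
  then have "{x. \<Phi> x \<le> a} \<in> sets borel"
    by (rule real_interval_borel_measurable)
  then show "{x \<in> space borel. \<Phi> x \<le> a} \<in> sets borel" by simp
qed

end

lemma modular_class:
  assumes "f' \<in> ae_rel M `` {f}"
  shows "(\<integral>\<^sup>+ x. \<Phi> (k * f' x) \<partial>M) = (\<integral>\<^sup>+ x. \<Phi> (k * f x) \<partial>M)"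
    and "(\<integral>\<^sup>+ x. \<Phi> (f' x / k) \<partial>M) = (\<integral>\<^sup>+ x. \<Phi> (f x / k) \<partial>M)"
  using assms unfolding in_ae_class by (auto intro!: nn_integral_cong_AE)

lemma orlicz_space_class:
  assumes f: "f \<in> borel_measurable M"
  shows "ae_rel M `` {f} \<in> orlicz_space M \<Phi> \<longleftrightarrow> (\<exists>k>0. (\<integral>\<^sup>+ x. \<Phi> (k * f x) \<partial>M) < \<infinity>)"
proof -
  have f_in: "f \<in> ae_rel M `` {f}"
    unfolding in_ae_class using f by auto
  have "ae_rel M `` {f} \<in> L0 M"
    unfolding L0_def using f by (rule quotientI)
  moreover have "(\<exists>f'\<in>ae_rel M `` {f}. \<exists>k>0. (\<integral>\<^sup>+ x. \<Phi> (k * f' x) \<partial>M) < \<infinity>) \<longleftrightarrow>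
      (\<exists>k>0. (\<integral>\<^sup>+ x. \<Phi> (k * f x) \<partial>M) < \<infinity>)" (is "?L \<longleftrightarrow> ?R")
  proof
    assume ?L
    then obtain f' k where *: "f' \<in> ae_rel M `` {f}" "k > 0" "(\<integral>\<^sup>+ x. \<Phi> (k * f' x) \<partial>M) < \<infinity>"
      by blast
    with modular_class(1)[OF *(1), of \<Phi> k] show ?R by (intro exI[of _ k]) simp
  qed (use f_in in blast)
  ultimately show ?thesis unfolding orlicz_space_def by simp
qed

lemma orlicz_norm_class:
  assumes f: "f \<in> borel_measurable M"
  shows "orlicz_norm M \<Phi> (ae_rel M `` {f}) = Inf {k. 0 < k \<and> (\<integral>\<^sup>+ x. \<Phi> (f x / k) \<partial>M) \<le> 1}"
proof -
  have f_in: "f \<in> ae_rel M `` {f}"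
    unfolding in_ae_class using f by auto
  have "(\<exists>f'\<in>ae_rel M `` {f}. (\<integral>\<^sup>+ x. \<Phi> (f' x / k) \<partial>M) \<le> 1) \<longleftrightarrow>
      (\<integral>\<^sup>+ x. \<Phi> (f x / k) \<partial>M) \<le> 1" (is "?L \<longleftrightarrow> ?R") for k
  proof
    assume ?L
    then obtain f' where *: "f' \<in> ae_rel M `` {f}" "(\<integral>\<^sup>+ x. \<Phi> (f' x / k) \<partial>M) \<le> 1"
      by blast
    with modular_class(2)[OF *(1), of \<Phi> k] show ?R by simp
  qed (use f_in in blast)
  then show ?thesis unfolding orlicz_norm_def by simp
qed

lemma orlicz_space_class_iff:
  assumes Y: "youngs_function \<Phi>" and f [measurable]: "f \<in> borel_measurable M"
  shows "ae_rel M `` {f} \<in> orlicz_space M \<Phi> \<longleftrightarrow> (\<exists>k>0. (\<integral>\<^sup>+ x. \<Phi> (f x / k) \<partial>M) \<le> 1)"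
proof
  note [measurable] = young_measurable[OF Y]
  assume "ae_rel M `` {f} \<in> orlicz_space M \<Phi>"
  then obtain k where k: "k > 0" "(\<integral>\<^sup>+ x. \<Phi> (k * f x) \<partial>M) < \<infinity>"
    using orlicz_space_class[OF f] by blast
  then obtain r where r: "(\<integral>\<^sup>+ x. \<Phi> (k * f x) \<partial>M) = ennreal r" "0 \<le> r"
    by (cases "\<integral>\<^sup>+ x. \<Phi> (k * f x) \<partial>M") auto
  define c where "c = 1 / (r + 1)"
  have c: "0 < c" "c \<le> 1" "c * r \<le> 1" using r(2) by (auto simp: c_def field_simps)
  have "(\<integral>\<^sup>+ x. \<Phi> (c * (k * f x)) \<partial>M) \<le> (\<integral>\<^sup>+ x. ennreal c * \<Phi> (k * f x) \<partial>M)"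
    using c by (intro nn_integral_mono young_scale[OF Y]) auto
  also have "\<dots> = ennreal (c * r)"
    using c r by (simp add: nn_integral_cmult ennreal_mult)
  also have "\<dots> \<le> 1" using c by simp
  finally have "(\<integral>\<^sup>+ x. \<Phi> (f x / (1 / (c * k))) \<partial>M) \<le> 1"
    by (simp add: mult_ac)
  then show "\<exists>k>0. (\<integral>\<^sup>+ x. \<Phi> (f x / k) \<partial>M) \<le> 1"
    using k c by (intro exI[of _ "1 / (c * k)"]) auto
next
  assume "\<exists>k>0. (\<integral>\<^sup>+ x. \<Phi> (f x / k) \<partial>M) \<le> 1"
  then obtain k where k: "k > 0" "(\<integral>\<^sup>+ x. \<Phi> (f x / k) \<partial>M) \<le> 1" by blast
  moreover have "(\<integral>\<^sup>+ x. \<Phi> (1 / k * f x) \<partial>M) < \<infinity>"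
    using le_less_trans[OF k(2), of \<infinity>] by simp
  ultimately show "ae_rel M `` {f} \<in> orlicz_space M \<Phi>"
    unfolding orlicz_space_class[OF f] by (intro exI[of _ "1 / k"]) simp
qed

lemma modular_add_le:
  assumes Y: "youngs_function \<Phi>"
    and [measurable]: "f \<in> borel_measurable M" "g \<in> borel_measurable M"
    and a: "0 < a" "(\<integral>\<^sup>+ x. \<Phi> (f x / a) \<partial>M) \<le> 1"
    and b: "0 < b" "(\<integral>\<^sup>+ x. \<Phi> (g x / b) \<partial>M) \<le> 1"
  shows "(\<integral>\<^sup>+ x. \<Phi> ((f x + g x) / (a + b)) \<partial>M) \<le> 1"
proof -
  note [measurable] = young_measurable[OF Y]
  define u v where "u = a / (a + b)" and "v = b / (a + b)"
  have uv: "0 \<le> u" "0 \<le> v" "u + v = 1"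
    using a b by (auto simp: u_def v_def simp flip: add_divide_distrib)
  have "(f x + g x) / (a + b) = u * (f x / a) + v * (g x / b)" for x
    using a b by (simp add: u_def v_def add_divide_distrib)
  then have "(\<integral>\<^sup>+ x. \<Phi> ((f x + g x) / (a + b)) \<partial>M)
      \<le> (\<integral>\<^sup>+ x. ennreal u * \<Phi> (f x / a) + ennreal v * \<Phi> (g x / b) \<partial>M)"
    using young_convex[OF Y uv] by (intro nn_integral_mono) (simp only:)
  also have "\<dots> = ennreal u * (\<integral>\<^sup>+ x. \<Phi> (f x / a) \<partial>M) + ennreal v * (\<integral>\<^sup>+ x. \<Phi> (g x / b) \<partial>M)"
    by (simp add: nn_integral_add nn_integral_cmult)
  also have "\<dots> \<le> ennreal u * 1 + ennreal v * 1"
    using a b by (intro add_mono mult_left_mono) auto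
  also have "\<dots> = 1" using uv by (simp flip: ennreal_plus)
  finally show ?thesis .
qed

lemma orlicz_dist_class:
  assumes "ae_rel M `` {f} \<in> orlicz_space M \<Phi>" "ae_rel M `` {g} \<in> orlicz_space M \<Phi>"
    and "f \<in> borel_measurable M" "g \<in> borel_measurable M"
  shows "orlicz_dist M \<Phi> (ae_rel M `` {f}) (ae_rel M `` {g}) =
    Inf {k. 0 < k \<and> (\<integral>\<^sup>+ x. \<Phi> ((f x - g x) / k) \<partial>M) \<le> 1}"
  using assms by (simp add: orlicz_dist_def L0_diff_class orlicz_norm_class)

lemma orlicz_diff_set_nonempty:
  assumes Y: "youngs_function \<Phi>"
    and "ae_rel M `` {f} \<in> orlicz_space M \<Phi>" "ae_rel M `` {g} \<in> orlicz_space M \<Phi>"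
    and [measurable]: "f \<in> borel_measurable M" "g \<in> borel_measurable M"
  shows "{k. 0 < k \<and> (\<integral>\<^sup>+ x. \<Phi> ((f x - g x) / k) \<partial>M) \<le> 1} \<noteq> {}"
proof -
  obtain a b where a: "0 < a" "(\<integral>\<^sup>+ x. \<Phi> (f x / a) \<partial>M) \<le> 1"
    and b: "0 < b" "(\<integral>\<^sup>+ x. \<Phi> (g x / b) \<partial>M) \<le> 1"
    using assms by (auto simp: orlicz_space_class_iff)
  have "(\<integral>\<^sup>+ x. \<Phi> (- g x / b) \<partial>M) \<le> 1" using b young_even[OF Y] by simp
  with modular_add_le[OF Y, of f M "\<lambda>x. - g x" a b] a b show ?thesis
    by (auto intro!: exI[of _ "a + b"])
qed

lemma modular_le_1_imp_AE_0:
  assumes Y: "youngs_function \<Phi>" and [measurable]: "f \<in> borel_measurable M"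
    and le: "\<And>k. 0 < k \<Longrightarrow> (\<integral>\<^sup>+ x. \<Phi> (f x / k) \<partial>M) \<le> 1"
  shows "AE x in M. f x = 0"
proof -
  note [measurable] = young_measurable[OF Y]
  let ?u = "\<lambda>n x. \<Phi> (f x / (1 / real (Suc n)))"
  have "(\<integral>\<^sup>+ x. liminf (\<lambda>n. ?u n x) \<partial>M) \<le> liminf (\<lambda>n. \<integral>\<^sup>+ x. ?u n x \<partial>M)"
    by (intro nn_integral_liminf) measurable
  also have "\<dots> \<le> liminf (\<lambda>n. 1)"
    by (intro Liminf_mono always_eventually allI le) auto
  finally have "(\<integral>\<^sup>+ x. liminf (\<lambda>n. ?u n x) \<partial>M) \<noteq> \<infinity>"
    by (auto simp: Liminf_const top_unique)
  then have "AE x in M. liminf (\<lambda>n. ?u n x) \<noteq> \<infinity>"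
    by (intro nn_integral_noteq_infinite) measurable
  moreover have "liminf (\<lambda>n. ?u n x) = \<infinity>" if "f x \<noteq> 0" for x
  proof (rule lim_imp_Liminf)
    have "filterlim (\<lambda>n. \<bar>f x\<bar> * real (Suc n)) at_top sequentially"
      using that
      by (intro filterlim_tendsto_pos_mult_at_top[OF tendsto_const]
            filterlim_compose[OF filterlim_real_sequentially filterlim_Suc]) auto
    from filterlim_compose[OF young_lim[OF Y] this]
    have "(\<lambda>n. \<Phi> \<bar>f x * real (Suc n)\<bar>) \<longlonglongrightarrow> \<infinity>" by (simp add: abs_mult)
    then show "(\<lambda>n. ?u n x) \<longlonglongrightarrow> \<infinity>" by (simp only: young_abs[OF Y] divide_divide_eq_right div_by_1)
  qed simp
  ultimately show ?thesis by auto
qed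

lemma modular_antimono:
  assumes Y: "youngs_function \<Phi>" and "0 < k" "k \<le> l"
  shows "(\<integral>\<^sup>+ x. \<Phi> (f x / l) \<partial>M) \<le> (\<integral>\<^sup>+ x. \<Phi> (f x / k) \<partial>M)"
  using assms by (intro nn_integral_mono young_mono[OF Y]) (auto intro!: divide_left_mono)

theorem Metric_space_orlicz:
  assumes Y: "youngs_function \<Phi>"
  shows "Metric_space (orlicz_space M \<Phi>) (orlicz_dist M \<Phi>)"
proof
  note [measurable] = young_measurable[OF Y]
  let ?A = "\<lambda>f. {k. 0 < k \<and> (\<integral>\<^sup>+ x. \<Phi> (f x / k) \<partial>M) \<le> 1}"
  have bdd: "bdd_below (?A f)" for f :: "'a \<Rightarrow> real" by (rule bdd_belowI[of _ 0]) auto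
  have rep: thesis
    if "F \<in> orlicz_space M \<Phi>" "\<And>f. f \<in> borel_measurable M \<Longrightarrow> F = ae_rel M `` {f} \<Longrightarrow> thesis"
    for F thesis
    using that L0E[of F M] unfolding orlicz_space_def by blast
  fix F G H
  show "0 \<le> orlicz_dist M \<Phi> F G"
  proof (cases "F \<in> orlicz_space M \<Phi> \<and> G \<in> orlicz_space M \<Phi>")
    case True
    then obtain f g where "f \<in> borel_measurable M" "F = ae_rel M `` {f}"
      "g \<in> borel_measurable M" "G = ae_rel M `` {g}"
      using rep[of F] rep[of G] by metis
    with True show ?thesis
      using orlicz_diff_set_nonempty[OF Y, of M f g] by (auto simp: orlicz_dist_class intro!: cInf_greatest)
  qed (auto simp: orlicz_dist_def)
  show "orlicz_dist M \<Phi> F G = orlicz_dist M \<Phi> G F"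
  proof (cases "F \<in> orlicz_space M \<Phi> \<and> G \<in> orlicz_space M \<Phi>")
    case True
    then obtain f g where "f \<in> borel_measurable M" "F = ae_rel M `` {f}"
      "g \<in> borel_measurable M" "G = ae_rel M `` {g}"
      using rep[of F] rep[of G] by metis
    moreover have "\<Phi> ((f x - g x) / k) = \<Phi> ((g x - f x) / k)" for x k
      using young_even[OF Y, of "(f x - g x) / k"]
      by (metis minus_diff_eq minus_divide_left)
    ultimately show ?thesis using True by (simp add: orlicz_dist_class)
  qed (auto simp: orlicz_dist_def)
  assume F: "F \<in> orlicz_space M \<Phi>" and G: "G \<in> orlicz_space M \<Phi>"
  then obtain f g where f [measurable]: "f \<in> borel_measurable M" and Ff: "F = ae_rel M `` {f}"
    and g [measurable]: "g \<in> borel_measurable M" and Gg: "G = ae_rel M `` {g}"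
    using rep[of F] rep[of G] by metis
  have dFG: "orlicz_dist M \<Phi> F G = Inf (?A (\<lambda>x. f x - g x))"
    using F G f g by (simp add: orlicz_dist_class Ff Gg)
  have neFG: "?A (\<lambda>x. f x - g x) \<noteq> {}"
    using orlicz_diff_set_nonempty[OF Y _ _ f g] F G Ff Gg by simp
  show "orlicz_dist M \<Phi> F G = 0 \<longleftrightarrow> F = G"
  proof
    assume "orlicz_dist M \<Phi> F G = 0"
    then have inf: "Inf (?A (\<lambda>x. f x - g x)) = 0" using dFG by simp
    have "(\<integral>\<^sup>+ x. \<Phi> ((f x - g x) / k) \<partial>M) \<le> 1" if "0 < k" for k
    proof -
      have "\<exists>l\<in>?A (\<lambda>x. f x - g x). l < k"
        by (rule cInf_lessD[OF neFG]) (simp only: inf that)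
      then obtain l where "0 < l" "l \<le> k" and l: "(\<integral>\<^sup>+ x. \<Phi> ((f x - g x) / l) \<partial>M) \<le> 1"
        by force
      then have "(\<integral>\<^sup>+ x. \<Phi> ((f x - g x) / k) \<partial>M) \<le> (\<integral>\<^sup>+ x. \<Phi> ((f x - g x) / l) \<partial>M)"
        by (intro modular_antimono[OF Y])
      with l show ?thesis by (rule order_trans[rotated])
    qed
    then have "AE x in M. f x - g x = 0"
      by (intro modular_le_1_imp_AE_0[OF Y]) auto
    then show "F = G" unfolding Ff Gg ae_class_eq[OF f g] by simp
  next
    assume "F = G"
    then have "AE x in M. f x = g x" using ae_class_eq[OF f g] Ff Gg by simp
    then have "(\<integral>\<^sup>+ x. \<Phi> ((f x - g x) / k) \<partial>M) = (\<integral>\<^sup>+ x. 0 \<partial>M)" for k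
      by (intro nn_integral_cong_AE) (auto simp: young_0[OF Y])
    then have "?A (\<lambda>x. f x - g x) = {0<..}" by auto
    then show "orlicz_dist M \<Phi> F G = 0" using dFG by simp
  qed
  assume H: "H \<in> orlicz_space M \<Phi>"
  then obtain h where h [measurable]: "h \<in> borel_measurable M" and Hh: "H = ae_rel M `` {h}"
    using rep[of H] by metis
  have neGH: "?A (\<lambda>x. g x - h x) \<noteq> {}"
    using orlicz_diff_set_nonempty[OF Y _ _ g h] G H Gg Hh by simp
  have *: "Inf (?A (\<lambda>x. f x - h x)) \<le> a + b"
    if "a \<in> ?A (\<lambda>x. f x - g x)" "b \<in> ?A (\<lambda>x. g x - h x)" for a b
  proof (rule cInf_lower[OF _ bdd])
    show "a + b \<in> ?A (\<lambda>x. f x - h x)"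
      using that modular_add_le[OF Y, of "\<lambda>x. f x - g x" M "\<lambda>x. g x - h x" a b] by simp
  qed
  have **: "Inf (?A (\<lambda>x. f x - h x)) - b \<le> Inf (?A (\<lambda>x. f x - g x))"
    if b: "b \<in> ?A (\<lambda>x. g x - h x)" for b
  proof (rule cInf_greatest[OF neFG])
    fix a assume "a \<in> ?A (\<lambda>x. f x - g x)"
    from *[OF this b] show "Inf (?A (\<lambda>x. f x - h x)) - b \<le> a" by linarith
  qed
  have "Inf (?A (\<lambda>x. f x - h x)) - Inf (?A (\<lambda>x. f x - g x)) \<le> Inf (?A (\<lambda>x. g x - h x))"
  proof (rule cInf_greatest[OF neGH])
    fix b assume "b \<in> ?A (\<lambda>x. g x - h x)"
    from **[OF this] show "Inf (?A (\<lambda>x. f x - h x)) - Inf (?A (\<lambda>x. f x - g x)) \<le> b" by linarith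
  qed
  then show "orlicz_dist M \<Phi> F H \<le> orlicz_dist M \<Phi> F G + orlicz_dist M \<Phi> G H"
    using F G H f g h by (simp add: orlicz_dist_class Ff Gg Hh)
qed

end

theory Submission
  imports Defs
begin

text \<open>Both directions go through the modular \<open>I f = \<integral>\<Phi> \<circ> f\<close>.
  If \<open>C\<^sub>\<phi>\<close> is continuous at \<open>0\<close> and \<open>I (f / k) \<le> 1\<close>, the truncations \<open>f\<^sub>n = f \<cdot> 1\<^bsub>{h \<le> n}\<^esub>\<close> lie in the
  domain, since \<open>I ((f\<^sub>n / k) \<circ> \<phi>) = \<integral> h \<cdot> \<Phi> (f\<^sub>n / k) \<le> n\<close>, and \<open>I (c f\<^sub>n \<circ> \<phi>) \<le> 1\<close> with \<open>c\<close>
  independent of \<open>n\<close>; as \<open>h < \<infinity>\<close> almost everywhere, monotone convergence gives \<open>I (c f \<circ> \<phi>) \<le> 1\<close>.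
  Conversely, if \<open>C\<^sub>\<phi>\<close> is everywhere defined but unbounded, there are \<open>f\<^sub>n\<close> with \<open>I f\<^sub>n \<le> 1\<close> and
  \<open>I (f\<^sub>n \<circ> \<phi> / 4\<^sup>n) > 1\<close>; then \<open>sup\<^sub>n \<bar>f\<^sub>n\<bar> / 2\<^sup>n\<close> is in the Orlicz space, but its image is not.\<close>

text \<open>The preimage of the exceptional null set is again null. This carries pointwise facts
  about \<open>s\<close> and \<open>h\<close> to points of the form \<open>\<phi> x\<close>.\<close>

lemma AE_nonsingular:
  assumes ns: "nonsingular M \<phi>" and P: "AE x in M. P x"
  shows "AE x in M. P (\<phi> x)"
proof -
  have phi: "\<phi> \<in> M \<rightarrow>\<^sub>M M" using ns by (simp add: nonsingular_def)
  obtain N where N: "{x \<in> space M. \<not> P x} \<subseteq> N" "emeasure M N = 0" "N \<in> sets M"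
    using AE_E[OF P] by metis
  show ?thesis
  proof (rule AE_I)
    show "{x \<in> space M. \<not> P (\<phi> x)} \<subseteq> \<phi> -` N \<inter> space M"
      using N(1) measurable_space[OF phi] by fastforce
    show "emeasure M (\<phi> -` N \<inter> space M) = 0"
      using N ns by (auto simp: nonsingular_def)
    show "\<phi> -` N \<inter> space M \<in> sets M"
      using N phi by (rule_tac measurable_sets)
  qed
qed

text \<open>Non-singularity is absolute continuity of the image measure, so Radon-Nikodym gives it a
  density with respect to \<open>M\<close>; the identity is then the change of variables
  formula.\<close>

lemma nn_integral_nonsingular:
  assumes "sigma_finite_measure M" and ns: "nonsingular M \<phi>"
    and u [measurable]: "u \<in> borel_measurable M"
  shows "(\<integral>\<^sup>+ x. u (\<phi> x) \<partial>M) = (\<integral>\<^sup>+ x. RN_deriv M (distr M M \<phi>) x * u x \<partial>M)"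
proof -
  interpret sigma_finite_measure M by fact
  have phi [measurable]: "\<phi> \<in> M \<rightarrow>\<^sub>M M" using ns by (simp add: nonsingular_def)
  have "absolutely_continuous M (distr M M \<phi>)"
    using ns by (auto simp: absolutely_continuous_def null_sets_def nonsingular_def emeasure_distr)
  then have "density M (RN_deriv M (distr M M \<phi>)) = distr M M \<phi>"
    by (intro density_RN_deriv) auto
  then have "(\<integral>\<^sup>+ x. u x \<partial>density M (RN_deriv M (distr M M \<phi>))) = (\<integral>\<^sup>+ x. u x \<partial>distr M M \<phi>)"
    by simp
  then show ?thesis
    by (simp add: nn_integral_distr nn_integral_density)
qed

lemma orlicz_spaceE:
  assumes "F \<in> orlicz_space M \<Phi>"
  obtains f where "f \<in> borel_measurable M" "F = ae_rel M `` {f}"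
  using assms L0E[of F M] unfolding orlicz_space_def by blast

lemma orlicz_dist_le:
  assumes "ae_rel M `` {f} \<in> orlicz_space M \<Phi>" "ae_rel M `` {g} \<in> orlicz_space M \<Phi>"
    and "f \<in> borel_measurable M" "g \<in> borel_measurable M"
    and "0 < k" "(\<integral>\<^sup>+ x. \<Phi> ((f x - g x) / k) \<partial>M) \<le> 1"
  shows "orlicz_dist M \<Phi> (ae_rel M `` {f}) (ae_rel M `` {g}) \<le> k"
  using assms unfolding orlicz_dist_class[OF assms(1-4)]
  by (intro cInf_lower bdd_belowI[of _ 0]) auto

text \<open>A distance strictly below \<open>k\<close> leaves room for an admissible divisor
  \<open>l < k\<close>, and the modular decreases in the divisor. Strictness matters: the infimum
  itself need not be admissible, for instance where \<open>\<Phi>\<close> jumps to infinity.\<close>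

lemma orlicz_dist_less_imp:
  assumes Y: "youngs_function \<Phi>"
    and fg: "ae_rel M `` {f} \<in> orlicz_space M \<Phi>" "ae_rel M `` {g} \<in> orlicz_space M \<Phi>"
      "f \<in> borel_measurable M" "g \<in> borel_measurable M"
    and less: "orlicz_dist M \<Phi> (ae_rel M `` {f}) (ae_rel M `` {g}) < k"
  shows "(\<integral>\<^sup>+ x. \<Phi> ((f x - g x) / k) \<partial>M) \<le> 1"
proof -
  obtain l where l: "0 < l" "l < k" "(\<integral>\<^sup>+ x. \<Phi> ((f x - g x) / l) \<partial>M) \<le> 1"
    using cInf_lessD[OF orlicz_diff_set_nonempty[OF Y fg], of k] less
    unfolding orlicz_dist_class[OF fg] by blast
  with modular_antimono[OF Y, where k = l and l = k and f = "\<lambda>x. f x - g x" and M = M] show ?thesis by auto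
qed

text \<open>This plays the role of the closed graph theorem: from a map defined everywhere it
  extracts a uniform bound, by merging a sequence of counterexamples into one function.\<close>

lemma comp_domain_eq_imp_bounded:
  assumes Y: "youngs_function \<Phi>" and ns: "nonsingular M \<phi>"
    and dom: "comp_domain M \<Phi> \<phi> = orlicz_space M \<Phi>"
  obtains K where "0 < K"
    "\<And>f. f \<in> borel_measurable M \<Longrightarrow> (\<integral>\<^sup>+ x. \<Phi> (f x) \<partial>M) \<le> 1 \<Longrightarrow> (\<integral>\<^sup>+ x. \<Phi> (f (\<phi> x) / K) \<partial>M) \<le> 1"
proof (rule ccontr)
  note [measurable] = young_measurable[OF Y]
  have phi [measurable]: "\<phi> \<in> M \<rightarrow>\<^sub>M M" using ns by (simp add: nonsingular_def)
  assume "\<not> thesis"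
  \<comment> \<open>The candidate bound \<open>4 ^ n\<close> splits as \<open>2 ^ n * 2 ^ n\<close>:
    one factor makes the supremum below lie in the Orlicz space, the other outgrows any fixed
    divisor \<open>k\<close>.\<close>
  then have "\<forall>n. \<exists>f. f \<in> borel_measurable M \<and> (\<integral>\<^sup>+ x. \<Phi> (f x) \<partial>M) \<le> 1 \<and>
      \<not> (\<integral>\<^sup>+ x. \<Phi> (f (\<phi> x) / 4 ^ n) \<partial>M) \<le> 1"
    using that by (metis zero_less_numeral zero_less_power)
  then obtain f where f [measurable]: "\<And>n. f n \<in> borel_measurable M"
    and f1: "\<And>n. (\<integral>\<^sup>+ x. \<Phi> (f n x) \<partial>M) \<le> 1"
    and f2: "\<And>n. \<not> (\<integral>\<^sup>+ x. \<Phi> (f n (\<phi> x) / 4 ^ n) \<partial>M) \<le> 1"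
    by metis
  define s where "s x = (SUP n. ennreal (\<bar>f n x\<bar> / 2 ^ n))" for x
  have s [measurable]: "s \<in> borel_measurable M" unfolding s_def by measurable
  \<comment> \<open>A single majorant for all \<open>\<Phi> (\<bar>f n x\<bar> / 2 ^ n)\<close>, by
    convexity and \<open>\<Phi> 0 = 0\<close>; the geometric weights keep its integral at most
    2.\<close>
  define W where "W x = (\<Sum>n. ennreal ((1 / 2) ^ n) * \<Phi> (f n x))" for x
  have W [measurable]: "W \<in> borel_measurable M" unfolding W_def by measurable
  have Phi_le: "\<Phi> (\<bar>f n x\<bar> / 2 ^ n) \<le> W x" for n x
  proof -
    have "\<Phi> (\<bar>f n x\<bar> / 2 ^ n) \<le> ennreal ((1 / 2) ^ n) * \<Phi> (f n x)"
      using young_scale[OF Y, of "(1 / 2) ^ n" "\<bar>f n x\<bar>"]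
      by (simp add: young_abs[OF Y] power_one_over power_le_one field_simps)
    also have "\<dots> \<le> W x"
      unfolding W_def using sum_le_suminf[of "\<lambda>n. ennreal ((1 / 2) ^ n) * \<Phi> (f n x)" "{n}"] by simp
    finally show ?thesis .
  qed
  have "(\<integral>\<^sup>+ x. W x \<partial>M) = (\<Sum>n. ennreal ((1 / 2) ^ n) * (\<integral>\<^sup>+ x. \<Phi> (f n x) \<partial>M))"
    unfolding W_def by (subst nn_integral_suminf) (auto simp: nn_integral_cmult)
  also have "\<dots> \<le> (\<Sum>n. ennreal ((1 / 2) ^ n) * 1)"
    using f1 by (intro suminf_le mult_left_mono) auto
  also have "\<dots> = ennreal 2"
    unfolding mult_1_right
    by (rule suminf_ennreal_eq) (use geometric_sums[of "1 / 2 :: real"] in simp_all)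
  finally have intW: "(\<integral>\<^sup>+ x. W x \<partial>M) < \<infinity>" by (auto intro: le_less_trans)
  then have "AE x in M. W x \<noteq> \<infinity>"
    by (intro nn_integral_noteq_infinite) auto
  then have s_fin: "AE x in M. s x < \<infinity>"
  proof eventually_elim
    case (elim x)
    \<comment> \<open>Since \<open>\<Phi>\<close> tends to infinity, a finite value of
      \<open>W x\<close> confines all the terms of the supremum to a bounded range.\<close>
    from young_lim[OF Y] elim have "eventually (\<lambda>t. W x < \<Phi> t) at_top"
      by (intro order_tendstoD(1)) (auto simp: top.not_eq_extremum)
    then obtain t where t: "\<And>u. t \<le> u \<Longrightarrow> W x < \<Phi> u"
      unfolding eventually_at_top_linorder by blast
    have "\<bar>f n x\<bar> / 2 ^ n \<le> t" for n
      using t[of "\<bar>f n x\<bar> / 2 ^ n"] Phi_le[of n x] by force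
    then have "s x \<le> ennreal t"
      unfolding s_def by (intro SUP_least ennreal_leI)
    then show ?case by (auto intro: le_less_trans)
  qed
  \<comment> \<open>\<open>enn2real\<close> sends infinity to 0. This changes \<open>s\<close> only
    on a null set, and there the bound by \<open>W\<close> holds because
    \<open>\<Phi> 0 = 0\<close>.\<close>
  let ?g = "\<lambda>x. enn2real (s x)"
  \<comment> \<open>\<open>\<Phi>\<close> need not be left continuous where it jumps to \<open>\<infinity>\<close>; halving makes the supremum exceeded by
    some term.\<close>
  have "\<Phi> (?g x / 2) \<le> W x" for x
  proof (cases "?g x = 0")
    case False
    then have "ennreal (?g x / 2) < s x"
      by (cases "s x") (auto simp: ennreal_less_iff)
    then obtain n where "ennreal (?g x / 2) < ennreal (\<bar>f n x\<bar> / 2 ^ n)"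
      unfolding s_def less_SUP_iff by blast
    then have "\<Phi> (?g x / 2) \<le> \<Phi> (\<bar>f n x\<bar> / 2 ^ n)"
      by (intro young_mono[OF Y]) (simp add: ennreal_less_iff)
    with Phi_le[of n x] show ?thesis by (rule order_trans[rotated])
  qed (simp add: young_0[OF Y])
  then have "(\<integral>\<^sup>+ x. \<Phi> (1 / 2 * ?g x) \<partial>M) \<le> (\<integral>\<^sup>+ x. W x \<partial>M)"
    by (intro nn_integral_mono) simp
  with intW have "ae_rel M `` {?g} \<in> orlicz_space M \<Phi>"
    by (subst orlicz_space_class) (auto intro!: exI[of _ "1 / 2"])
  then have "ae_rel M `` {?g} \<in> comp_domain M \<Phi> \<phi>" unfolding dom .
  then have "ae_rel M `` {?g \<circ> \<phi>} \<in> orlicz_space M \<Phi>"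
    by (simp add: comp_domain_def comp_op_class[OF ns])
  then obtain k where k: "0 < k" "(\<integral>\<^sup>+ x. \<Phi> (?g (\<phi> x) / k) \<partial>M) \<le> 1"
    by (subst (asm) orlicz_space_class_iff[OF Y]) auto
  \<comment> \<open>For this \<open>n\<close> the spare factor \<open>2 ^ n\<close> exceeds
    \<open>k\<close>, so \<open>f n (\<phi> x) / 4 ^ n\<close> is dominated by
    \<open>?g (\<phi> x) / k\<close>, against the choice of \<open>f n\<close>.\<close>
  obtain n where n: "k < 2 ^ n" using real_arch_pow[of 2 k] by auto
  have "(\<integral>\<^sup>+ x. \<Phi> (f n (\<phi> x) / 4 ^ n) \<partial>M) \<le> (\<integral>\<^sup>+ x. \<Phi> (?g (\<phi> x) / k) \<partial>M)"
  proof (intro nn_integral_mono_AE, use AE_nonsingular[OF ns s_fin] in eventually_elim)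
    case (elim x)
    have "ennreal (\<bar>f n (\<phi> x)\<bar> / 2 ^ n) \<le> s (\<phi> x)" unfolding s_def by (rule SUP_upper) simp
    with elim have le: "\<bar>f n (\<phi> x)\<bar> / 2 ^ n \<le> ?g (\<phi> x)" by (cases "s (\<phi> x)") auto
    have "\<bar>f n (\<phi> x) / 4 ^ n\<bar> = \<bar>f n (\<phi> x)\<bar> / 2 ^ n / 2 ^ n"
      by (simp add: abs_divide flip: power_mult_distrib)
    also have "\<dots> \<le> ?g (\<phi> x) / k" using le n k by (intro frac_le) auto
    also have "\<dots> \<le> \<bar>?g (\<phi> x) / k\<bar>" by (rule abs_ge_self)
    finally show ?case by (rule young_mono[OF Y])
  qed
  with k(2) f2[of n] show False by simp
qed

text \<open>Removes the restriction to the domain from the estimate that continuity at 0 provides: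
  truncations of any \<open>f\<close> do lie in the domain, and the bound on them is
  uniform.\<close>

lemma modular_comp_le_if_bounded_on_domain:
  assumes "sigma_finite_measure M" and Y: "youngs_function \<Phi>" and ns: "nonsingular M \<phi>"
    and h_fin: "AE x in M. RN_deriv M (distr M M \<phi>) x < \<infinity>"
    and c: "0 < c"
    and bound: "\<And>g. g \<in> borel_measurable M \<Longrightarrow> ae_rel M `` {g} \<in> comp_domain M \<Phi> \<phi> \<Longrightarrow>
      (\<integral>\<^sup>+ x. \<Phi> (g x / c) \<partial>M) \<le> 1 \<Longrightarrow> (\<integral>\<^sup>+ x. \<Phi> (g (\<phi> x)) \<partial>M) \<le> 1"
    and f [measurable]: "f \<in> borel_measurable M" and f1: "(\<integral>\<^sup>+ x. \<Phi> (f x / c) \<partial>M) \<le> 1"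
  shows "(\<integral>\<^sup>+ x. \<Phi> (f (\<phi> x)) \<partial>M) \<le> 1"
proof -
  note [measurable] = young_measurable[OF Y]
  have phi [measurable]: "\<phi> \<in> M \<rightarrow>\<^sub>M M" using ns by (simp add: nonsingular_def)
  define h where "h = RN_deriv M (distr M M \<phi>)"
  have h [measurable]: "h \<in> borel_measurable M" unfolding h_def by simp
  define g where "g n x = (if h x \<le> of_nat n then f x else 0)" for n x
  have g [measurable]: "g n \<in> borel_measurable M" for n unfolding g_def by measurable
  have g_le: "\<bar>g n x\<bar> \<le> \<bar>f x\<bar>" for n x by (simp add: g_def)
  have g1: "(\<integral>\<^sup>+ x. \<Phi> (g n x / c) \<partial>M) \<le> 1" for n
  proof -
    have "(\<integral>\<^sup>+ x. \<Phi> (g n x / c) \<partial>M) \<le> (\<integral>\<^sup>+ x. \<Phi> (f x / c) \<partial>M)"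
      using g_le c by (intro nn_integral_mono young_mono[OF Y]) (simp add: divide_right_mono)
    with f1 show ?thesis by simp
  qed
  have "(\<integral>\<^sup>+ x. \<Phi> (g n (\<phi> x)) \<partial>M) \<le> 1" for n
  proof (rule bound[OF g _ g1])
    have "(\<integral>\<^sup>+ x. \<Phi> (g n (\<phi> x) / c) \<partial>M) = (\<integral>\<^sup>+ x. h x * \<Phi> (g n x / c) \<partial>M)"
      unfolding h_def by (rule nn_integral_nonsingular[OF assms(1) ns]) measurable
    \<comment> \<open>Where \<open>h\<close> exceeds \<open>n\<close>, the factor
      \<open>\<Phi> (g n x / c)\<close> is \<open>\<Phi> 0 = 0\<close>, and the product vanishes
      even if \<open>h x\<close> is infinite.\<close>
    also have "\<dots> \<le> (\<integral>\<^sup>+ x. of_nat n * \<Phi> (g n x / c) \<partial>M)"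
      by (intro nn_integral_mono) (auto simp: g_def young_0[OF Y] intro: mult_right_mono)
    also have "\<dots> = of_nat n * (\<integral>\<^sup>+ x. \<Phi> (g n x / c) \<partial>M)"
      by (simp add: nn_integral_cmult)
    also have "\<dots> \<le> of_nat n * 1" by (intro mult_left_mono g1) simp
    finally have "(\<integral>\<^sup>+ x. \<Phi> (g n (\<phi> x) / c) \<partial>M) < \<infinity>"
      by (auto intro: le_less_trans simp: of_nat_less_top)
    then have "ae_rel M `` {g n \<circ> \<phi>} \<in> orlicz_space M \<Phi>"
      using c by (subst orlicz_space_class) (auto intro!: exI[of _ "1 / c"])
    moreover have "ae_rel M `` {g n} \<in> orlicz_space M \<Phi>"
      unfolding orlicz_space_class_iff[OF Y g] using g1 c by blast
    ultimately show "ae_rel M `` {g n} \<in> comp_domain M \<Phi> \<phi>"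
      by (simp add: comp_domain_def comp_op_class[OF ns g])
  qed
  \<comment> \<open>Almost everywhere the truncations equal \<open>f (\<phi> x)\<close> from some
    \<open>n\<close> on, so passing to the supremum is safe even where \<open>\<Phi>\<close>
    jumps.\<close>
  moreover have "(\<integral>\<^sup>+ x. \<Phi> (f (\<phi> x)) \<partial>M) \<le> (\<integral>\<^sup>+ x. (SUP n. \<Phi> (g n (\<phi> x))) \<partial>M)"
  proof (intro nn_integral_mono_AE, use AE_nonsingular[OF ns h_fin] in eventually_elim)
    case (elim x)
    then obtain n where "h (\<phi> x) \<le> of_nat n"
      unfolding h_def[symmetric] using ennreal_Ex_less_of_nat[of "h (\<phi> x)"] by (auto intro: less_imp_le)
    then have "\<Phi> (f (\<phi> x)) = \<Phi> (g n (\<phi> x))" by (simp add: g_def)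
    then show ?case by (metis SUP_upper UNIV_I)
  qed
  moreover have "(\<integral>\<^sup>+ x. (SUP n. \<Phi> (g n (\<phi> x))) \<partial>M) = (SUP n. \<integral>\<^sup>+ x. \<Phi> (g n (\<phi> x)) \<partial>M)"
  proof (rule nn_integral_monotone_convergence_SUP)
    show "incseq (\<lambda>n x. \<Phi> (g n (\<phi> x)))"
      by (intro incseq_SucI le_funI young_mono[OF Y]) (auto simp: g_def intro: order_trans)
  qed measurable
  ultimately show ?thesis by (metis (no_types, lifting) SUP_least order_trans)
qed

theorem theorem3p11:
  fixes M :: "'a measure" and \<Phi> :: "real \<Rightarrow> ennreal" and \<phi> :: "'a \<Rightarrow> 'a"
  assumes "complete_measure M" and "sigma_finite_measure M"
    and "youngs_function \<Phi>"
    and "nonsingular M \<phi>"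
    and "AE x in M. RN_deriv M (distr M M \<phi>) x < \<infinity>"
    and "Delta_prime (complementary \<Phi>)"
  shows "continuous_map
           (Metric_space.mtopology (comp_domain M \<Phi> \<phi>) (orlicz_dist M \<Phi>))
           (Metric_space.mtopology (orlicz_space M \<Phi>) (orlicz_dist M \<Phi>))
           (comp_op M \<phi>)
         \<longleftrightarrow> comp_domain M \<Phi> \<phi> = orlicz_space M \<Phi>"
proof -
  note Y = assms(3) and ns = assms(4)
  note [measurable] = young_measurable[OF Y]
  have phi [measurable]: "\<phi> \<in> M \<rightarrow>\<^sub>M M" using ns by (simp add: nonsingular_def)
  interpret L: Metric_space "orlicz_space M \<Phi>" "orlicz_dist M \<Phi>"
    by (rule Metric_space_orlicz[OF Y])
  have sub: "comp_domain M \<Phi> \<phi> \<subseteq> orlicz_space M \<Phi>" by (auto simp: comp_domain_def)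
  interpret D: Metric_space "comp_domain M \<Phi> \<phi>" "orlicz_dist M \<Phi>"
    by (rule L.subspace[OF sub])
  note continuous_iff = D.metric_continuous_map[OF L.Metric_space_axioms]
  show ?thesis
  proof
    let ?O = "ae_rel M `` {\<lambda>_. 0}"
    assume "continuous_map D.mtopology L.mtopology (comp_op M \<phi>)"
    then have cont: "\<forall>a\<in>comp_domain M \<Phi> \<phi>. \<forall>\<epsilon>>0. \<exists>\<delta>>0. \<forall>x. x \<in> comp_domain M \<Phi> \<phi> \<and>
        orlicz_dist M \<Phi> a x < \<delta> \<longrightarrow> orlicz_dist M \<Phi> (comp_op M \<phi> a) (comp_op M \<phi> x) < \<epsilon>"
      by (simp add: continuous_iff)
    have O: "?O \<in> orlicz_space M \<Phi>"
      by (subst orlicz_space_class) (auto simp: young_0[OF Y] intro: exI[of _ 1])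
    moreover have CO: "comp_op M \<phi> ?O = ?O"
      by (subst comp_op_class[OF ns]) (auto simp: comp_def)
    ultimately have "?O \<in> comp_domain M \<Phi> \<phi>" by (simp add: comp_domain_def)
    \<comment> \<open>Continuity at the zero class with radius 1, since distance less than 1 to zero
      forces the modular to be at most 1.\<close>
    with cont CO obtain \<delta> where \<delta>: "\<delta> > 0" "\<And>F. F \<in> comp_domain M \<Phi> \<phi> \<Longrightarrow>
        orlicz_dist M \<Phi> F ?O < \<delta> \<Longrightarrow> orlicz_dist M \<Phi> (comp_op M \<phi> F) ?O < 1"
      by (metis L.commute zero_less_one)
    \<comment> \<open>A modular bound yields only a non-strict distance estimate; halving
      \<open>\<delta>\<close> makes it strict.\<close>
    have bound: "(\<integral>\<^sup>+ x. \<Phi> (g (\<phi> x)) \<partial>M) \<le> 1"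
      if g [measurable]: "g \<in> borel_measurable M" and gD: "ae_rel M `` {g} \<in> comp_domain M \<Phi> \<phi>"
        and g1: "(\<integral>\<^sup>+ x. \<Phi> (g x / (\<delta> / 2)) \<partial>M) \<le> 1" for g
    proof -
      from gD have gL: "ae_rel M `` {g} \<in> orlicz_space M \<Phi>"
        and gC: "ae_rel M `` {g \<circ> \<phi>} \<in> orlicz_space M \<Phi>"
        by (auto simp: comp_domain_def comp_op_class[OF ns])
      have "orlicz_dist M \<Phi> (ae_rel M `` {g}) ?O \<le> \<delta> / 2"
        using g1 \<delta>(1) by (intro orlicz_dist_le[OF gL O]) auto
      with \<delta> gD have "orlicz_dist M \<Phi> (ae_rel M `` {g \<circ> \<phi>}) ?O < 1"
        by (simp flip: comp_op_class[OF ns g])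
      then show ?thesis
        using orlicz_dist_less_imp[OF Y gC O, of 1] by simp
    qed
    show "comp_domain M \<Phi> \<phi> = orlicz_space M \<Phi>"
    proof (rule equalityI[OF sub], rule subsetI)
      fix F assume F: "F \<in> orlicz_space M \<Phi>"
      then obtain f where f [measurable]: "f \<in> borel_measurable M" and Ff: "F = ae_rel M `` {f}"
        by (rule orlicz_spaceE)
      then obtain k where k: "0 < k" "(\<integral>\<^sup>+ x. \<Phi> (f x / k) \<partial>M) \<le> 1"
        using F orlicz_space_class_iff[OF Y f] by auto
      \<comment> \<open>Chosen so that \<open>c * f\<close> divided by \<open>\<delta> / 2\<close>
        is \<open>f / k\<close>, whose modular is at most 1.\<close>
      define c where "c = \<delta> / (2 * k)"
      have c: "0 < c" using \<delta> k by (simp add: c_def)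
      have "c * f x / (\<delta> / 2) = f x / k" for x using \<delta> k by (simp add: c_def)
      then have "(\<integral>\<^sup>+ x. \<Phi> (c * f (\<phi> x)) \<partial>M) \<le> 1"
        using \<delta>(1) bound k
        by (intro modular_comp_le_if_bounded_on_domain[OF assms(2) Y ns assms(5),
            of "\<delta> / 2" "\<lambda>x. c * f x"]) auto
      then have "ae_rel M `` {f \<circ> \<phi>} \<in> orlicz_space M \<Phi>"
        using c by (subst orlicz_space_class) (auto intro!: exI[of _ c] intro: le_less_trans)
      with F show "F \<in> comp_domain M \<Phi> \<phi>"
        by (simp add: comp_domain_def Ff comp_op_class[OF ns f])
    qed
  next
    assume dom: "comp_domain M \<Phi> \<phi> = orlicz_space M \<Phi>"
    obtain K where K: "0 < K"
      "\<And>f. f \<in> borel_measurable M \<Longrightarrow> (\<integral>\<^sup>+ x. \<Phi> (f x) \<partial>M) \<le> 1 \<Longrightarrow> (\<integral>\<^sup>+ x. \<Phi> (f (\<phi> x) / K) \<partial>M) \<le> 1"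
      using comp_domain_eq_imp_bounded[OF Y ns dom] by blast
    show "continuous_map D.mtopology L.mtopology (comp_op M \<phi>)"
      unfolding continuous_iff
    proof (intro conjI ballI allI impI)
      show "comp_op M \<phi> ` comp_domain M \<Phi> \<phi> \<subseteq> orlicz_space M \<Phi>"
        by (auto simp: comp_domain_def)
      fix F :: "('a \<Rightarrow> real) set" and \<epsilon> :: real
      assume FD: "F \<in> comp_domain M \<Phi> \<phi>" and \<epsilon>: "0 < \<epsilon>"
      \<comment> \<open>In the radius \<open>\<epsilon> / (2 * K)\<close>, the factor
        \<open>K\<close> absorbs the bound, applied to the scaled difference \<open>f - g\<close>,
        and the factor 2 leaves \<open>\<epsilon> / 2\<close>, hence a strict inequality.\<close>
      have "orlicz_dist M \<Phi> (comp_op M \<phi> F) (comp_op M \<phi> G) < \<epsilon>"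
        if GD: "G \<in> comp_domain M \<Phi> \<phi>" and dFG: "orlicz_dist M \<Phi> F G < \<epsilon> / (2 * K)" for G
      proof -
        from FD GD have FL: "F \<in> orlicz_space M \<Phi>" "comp_op M \<phi> F \<in> orlicz_space M \<Phi>"
          and GL: "G \<in> orlicz_space M \<Phi>" "comp_op M \<phi> G \<in> orlicz_space M \<Phi>"
          by (auto simp: comp_domain_def)
        obtain f where f [measurable]: "f \<in> borel_measurable M" and Ff: "F = ae_rel M `` {f}"
          using FL(1) by (rule orlicz_spaceE)
        obtain g where g [measurable]: "g \<in> borel_measurable M" and Gg: "G = ae_rel M `` {g}"
          using GL(1) by (rule orlicz_spaceE)
        have "(\<integral>\<^sup>+ x. \<Phi> ((f x - g x) / (\<epsilon> / (2 * K))) \<partial>M) \<le> 1"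
          using FL GL dFG unfolding Ff Gg by (intro orlicz_dist_less_imp[OF Y]) auto
        then have "(\<integral>\<^sup>+ x. \<Phi> ((f (\<phi> x) - g (\<phi> x)) / (\<epsilon> / (2 * K)) / K) \<partial>M) \<le> 1"
          by (intro K(2)) auto
        moreover have "t / (\<epsilon> / (2 * K)) / K = t / (\<epsilon> / 2)" for t using K(1) by simp
        ultimately have "orlicz_dist M \<Phi> (comp_op M \<phi> F) (comp_op M \<phi> G) \<le> \<epsilon> / 2"
          using FL GL \<epsilon> unfolding Ff Gg comp_op_class[OF ns f] comp_op_class[OF ns g]
          by (intro orlicz_dist_le) (simp_all del: divide_divide_eq_right divide_divide_eq_left)
        with \<epsilon> show ?thesis by simp
      qed
      moreover have "0 < \<epsilon> / (2 * K)" using \<epsilon> K by simp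
      ultimately show "\<exists>\<delta>>0. \<forall>G. G \<in> comp_domain M \<Phi> \<phi> \<and> orlicz_dist M \<Phi> F G < \<delta> \<longrightarrow>
          orlicz_dist M \<Phi> (comp_op M \<phi> F) (comp_op M \<phi> G) < \<epsilon>"
        by blast
    qed
  qed
qed

end
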